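(* Let $\varepsilon=\varepsilon(n)$ be a real sequence satisfying $\varepsilon\to 0$ and $\varepsilon^3 n\to\infty$ as $n\to\infty$, and let $p=p(n)=(1+\varepsilon)/n$. Then $$L_1(G_{n,p}) = (2+o_{\mathrm p}(1))\,\varepsilon n .$$ That is, for every fixed $\delta>0$, the probability that $(2-\delta)\varepsilon n\le L_1(G_{n,p})\le (2+\delta)\varepsilon n$ tends to $1$ as $n\to\infty$.
   Context: $G_{n,p}$ denotes the random graph with vertex set $[n]=\{1,2,\ldots,n\}$ in which each of the $\binom n2$ possible edges is present independently with probability $p$. (Under the assumptions, $\varepsilon>0$ and $p\in[0,1]$ for all sufficiently large $n$, and only such $n$ matter.) For a graph $G$, $L_1(G)$ is the maximal number of vertices in a (connected) component of $G$. The symbol $o_{\mathrm p}(1)$ denotes a quantity that tends to $0$ in probability as $n\to\infty$. *)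

theory Defs
  imports "HOL-Probability.Probability"
begin

text \<open>
  A finite simple graph is given by its vertex set \<open>V\<close> and its set \<open>E\<close> of edges, where an edge
  is a two-element subset of \<open>V\<close>.
\<close>

definition all_edges :: "'a set \<Rightarrow> 'a set set" where
  "all_edges V = {e. e \<subseteq> V \<and> card e = 2}"

definition joined :: "'a set \<Rightarrow> 'a set set \<Rightarrow> ('a \<times> 'a) set" where
  "joined V E = {(u, v). u \<in> V \<and> v \<in> V \<and> (u, v) \<in> {(x, y). {x, y} \<in> E}\<^sup>*}"

lemma equiv_joined: "equiv V (joined V E)"
proof (rule equivI)
  have "sym {(x, y). {x, y} \<in> E}"
    by (auto simp: sym_def insert_commute)
  then have "sym ({(x, y). {x, y} \<in> E}\<^sup>*)"
    by (rule sym_rtrancl)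
  then show "sym (joined V E)"
    by (auto simp: joined_def sym_def)
qed (auto simp: joined_def refl_on_def intro!: transI)

definition components :: "'a set \<Rightarrow> 'a set set \<Rightarrow> 'a set set" where
  "components V E = V // joined V E"

text \<open>Only meaningful for finite nonempty \<open>V\<close>.\<close>

definition L1 :: "'a set \<Rightarrow> 'a set set \<Rightarrow> nat" where
  "L1 V E = Max (card ` components V E)"

text \<open>
  The distribution of the edge set of \<open>G\<^sub>n\<^sub>,\<^sub>p\<close> on the vertex set \<open>{1..n}\<close>: one independent
  Bernoulli variable per possible edge. Outside \<open>[0, 1]\<close> the value of \<open>p\<close> is clamped by \<open>bernoulli_pmf\<close>.
\<close>

definition G_np :: "nat \<Rightarrow> real \<Rightarrow> nat set set pmf" where
  "G_np n p =
     map_pmf (\<lambda>f. {e \<in> all_edges {1..n}. f e})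
       (Pi_pmf (all_edges {1..n}) False (\<lambda>_. bernoulli_pmf p))"

end

theory Submission
  imports Defs
begin

text \<open>
  A graph is explored vertex by vertex: deleting a vertex \<open>v\<close> from the random graph leaves a random
  graph on the remaining vertices that is independent of the neighbourhood of \<open>v\<close>. Hence the number of
  vertices not yet discovered after \<open>k\<close> steps is distributed like \<open>Bin(u, (1 - p)\<^sup>k)\<close>, and its
  deviation from the mean, rescaled, is a martingale. Conditional second moments of this martingale
  bound the relevant probabilities by backward induction along the exploration, which amounts to a
  Kolmogorov--Doob maximal inequality. Up to an error of order smaller than \<open>\<epsilon>\<^sup>2 n\<close>, the number of active
  vertices follows the parabola \<open>\<epsilon> k - k\<^sup>2 / (2 n)\<close>, which is positive between \<open>0\<close> and \<open>2 \<epsilon> n\<close>.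

  For the lower bound, fix a small \<open>\<eta>\<close>: about \<open>\<epsilon>\<^sup>2 n\<close> vertices are reserved as starting points of new components. As long
  as the deviation is small, none of them is needed between times \<open>\<eta> \<epsilon> n\<close> and \<open>(2 - \<eta>) \<epsilon> n\<close>, so that all
  vertices explored in this period lie in one component.

  For the upper bound, the components meeting a fixed set of about \<open>\<delta> \<epsilon>\<^sup>2 n / 4\<close> vertices have, with high
  probability, fewer than \<open>(2 + \<delta>) \<epsilon> n\<close> vertices in total. A component with more vertices would be met
  by a random set of this size except with probability \<open>exp (- \<delta> \<epsilon>\<^sup>3 n / 2)\<close>.
\<close>

subsection \<open>Random subsets\<close>

definition random_subset :: "real \<Rightarrow> 'a set \<Rightarrow> 'a set pmf" where
  "random_subset p X = map_pmf (\<lambda>f. {x \<in> X. f x}) (Pi_pmf X False (\<lambda>_. bernoulli_pmf p))"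

lemma random_subset_empty: "random_subset p {} = return_pmf {}"
  by (simp add: random_subset_def)

lemma random_subset_insert:
  assumes "finite X" "x \<notin> X"
  shows "random_subset p (insert x X) =
    bernoulli_pmf p \<bind> (\<lambda>b. map_pmf (\<lambda>S. if b then insert x S else S) (random_subset p X))"
proof -
  have eq: "{y \<in> insert x X. (f(x := b)) y} = (if b then insert x {y \<in> X. f y} else {y \<in> X. f y})"
    for f :: "'a \<Rightarrow> bool" and b
    using assms by auto
  show ?thesis
    unfolding random_subset_def Pi_pmf_insert'[OF assms]
    by (simp only: map_bind_pmf map_return_pmf eq)
      (simp add: map_pmf_def bind_assoc_pmf bind_return_pmf)
qed

lemma set_pmf_random_subset: "finite X \<Longrightarrow> set_pmf (random_subset p X) \<subseteq> Pow X"
  by (auto simp: random_subset_def)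

lemma finite_set_pmf_random_subset: "finite X \<Longrightarrow> finite (set_pmf (random_subset p X))"
  using set_pmf_random_subset finite_subset finite_Pow_iff by metis

lemma random_subset_Un:
  assumes "finite X" "finite Y" "X \<inter> Y = {}"
  shows "random_subset p (X \<union> Y) =
    random_subset p X \<bind> (\<lambda>S. map_pmf (\<lambda>T. S \<union> T) (random_subset p Y))"
  using assms
proof (induction X rule: finite_induct)
  case empty
  have "(\<union>) {} = (id :: 'a set \<Rightarrow> 'a set)" by auto
  then show ?case by (simp add: random_subset_empty bind_return_pmf)
next
  case (insert x X)
  have [simp]: "(if b then insert x (S \<union> T) else S \<union> T) = (if b then insert x S else S) \<union> T" for b S T
    by auto
  show ?case
    using insert
    by (simp add: random_subset_insert bind_assoc_pmf bind_map_pmf map_bind_pmf pmf.map_comp o_def)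
qed

lemma random_subset_image:
  assumes "finite X" "inj_on f X"
  shows "random_subset p (f ` X) = map_pmf ((`) f) (random_subset p X)"
  using assms
proof (induction X rule: finite_induct)
  case empty
  then show ?case by (simp add: random_subset_empty)
next
  case (insert x X)
  have [simp]: "f ` (if b then insert x S else S) = (if b then insert (f x) (f ` S) else f ` S)" for b S
    by auto
  show ?case
    using insert
    by (simp add: random_subset_insert map_bind_pmf pmf.map_comp o_def)
qed

lemma expectation_mono_pmf:
  fixes f g :: "'a \<Rightarrow> real"
  assumes "finite (set_pmf M)" "\<And>x. x \<in> set_pmf M \<Longrightarrow> f x \<le> g x"
  shows "measure_pmf.expectation M f \<le> measure_pmf.expectation M g"
  using assms by (intro integral_mono_AE) (auto simp: integrable_measure_pmf_finite AE_measure_pmf_iff)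

lemma expectation_bind_pmf:
  fixes h :: "'b \<Rightarrow> real"
  assumes "finite (set_pmf M)" "\<And>x. finite (set_pmf (f x))"
  shows "measure_pmf.expectation (M \<bind> f) h =
    measure_pmf.expectation M (\<lambda>x. measure_pmf.expectation (f x) h)"
  using assms by (simp add: pmf_expectation_bind[of "set_pmf M"] integral_measure_pmf[of "set_pmf M"])

lemma prob_bind_pmf:
  assumes "finite (set_pmf M)" "\<And>x. finite (set_pmf (f x))"
  shows "measure_pmf.prob (M \<bind> f) S = measure_pmf.expectation M (\<lambda>x. measure_pmf.prob (f x) S)"
  using expectation_bind_pmf[OF assms, where h = "indicator S"] by simp

lemma prob_bind_pmf_le:
  assumes "finite (set_pmf M)" "\<And>x. finite (set_pmf (f x))"
    and "\<And>x. x \<in> set_pmf M \<Longrightarrow> measure_pmf.prob (f x) S \<le> g x"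
  shows "measure_pmf.prob (M \<bind> f) S \<le> measure_pmf.expectation M g"
  unfolding prob_bind_pmf[OF assms(1,2)] using assms(1,3) by (rule expectation_mono_pmf)

text \<open>
  For a random variable \<open>Y\<close> with distribution \<open>Bin(u, x)\<close>, \<open>sqdev c x u\<close> is the mean of \<open>(Y - c)\<^sup>2\<close>.
\<close>

definition sqdev :: "real \<Rightarrow> real \<Rightarrow> real \<Rightarrow> real" where
  "sqdev c x u = (u * x - c)\<^sup>2 + u * x * (1 - x)"

text \<open>Thinning: avoiding \<open>N\<close> and then surviving with probability \<open>x\<close>
  amounts to surviving with probability \<open>(1 - p) * x\<close>. This is the martingale property
  behind all later bounds.\<close>

lemma expectation_sqdev:
  assumes "finite U" "0 \<le> p" "p \<le> 1"
  shows "measure_pmf.expectation (random_subset p U) (\<lambda>N. sqdev c x (card (U - N)))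
         = sqdev c ((1 - p) * x) (card U)"
  using assms(1)
proof (induction U arbitrary: c rule: finite_induct)
  case empty
  then show ?case by (simp add: random_subset_empty sqdev_def)
next
  case (insert w U)
  let ?E = "\<lambda>g. measure_pmf.expectation (random_subset p U) (g :: 'a set \<Rightarrow> real)"
  have fin: "finite (set_pmf (random_subset p U))"
    using insert by (simp add: finite_set_pmf_random_subset)
  have A: "?E (\<lambda>N. sqdev c x (card (insert w U - insert w N))) = ?E (\<lambda>N. sqdev c x (card (U - N)))"
    using insert by (intro arg_cong[where f = ?E] ext) (simp add: insert_Diff_if Diff_insert0)
  \<comment> \<open>A kept \<open>w\<close> adds an independent Bernoulli variable: its mean
    \<open>x\<close> moves the centre to \<open>c - x\<close>, and its variance is
    \<open>x * (1 - x)\<close>.\<close>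
  have "?E (\<lambda>N. sqdev c x (card (insert w U - N))) =
        ?E (\<lambda>N. sqdev (c - x) x (card (U - N)) + x * (1 - x))"
  proof (intro integral_cong_AE)
    show "AE N in random_subset p U. sqdev c x (card (insert w U - N)) =
        sqdev (c - x) x (card (U - N)) + x * (1 - x)"
    proof (rule AE_pmfI)
      fix N assume "N \<in> set_pmf (random_subset p U)"
      then have "w \<notin> N" using set_pmf_random_subset insert by blast
      then have "card (insert w U - N) = Suc (card (U - N))"
        using insert by (simp add: insert_Diff_if)
      then show "sqdev c x (card (insert w U - N)) = sqdev (c - x) x (card (U - N)) + x * (1 - x)"
        by (simp add: sqdev_def power2_eq_square algebra_simps)
    qed
  qed auto
  also have "\<dots> = ?E (\<lambda>N. sqdev (c - x) x (card (U - N))) + x * (1 - x)"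
    using fin by (subst Bochner_Integration.integral_add) (auto simp: integrable_measure_pmf_finite)
  finally have B: "?E (\<lambda>N. sqdev c x (card (insert w U - N))) =
     sqdev (c - x) ((1 - p) * x) (card U) + x * (1 - x)"
    using insert.IH by simp
  have "measure_pmf.expectation (random_subset p (insert w U)) (\<lambda>N. sqdev c x (card (insert w U - N)))
      = p * ?E (\<lambda>N. sqdev c x (card (insert w U - insert w N)))
       + (1 - p) * ?E (\<lambda>N. sqdev c x (card (insert w U - N)))"
    unfolding random_subset_insert[OF insert(1,2)]
    using assms(2,3) fin
    by (subst expectation_bind_pmf) (auto intro: finite_subset[OF subset_UNIV])
  also have "\<dots> = sqdev c ((1 - p) * x) (card (insert w U))"
    unfolding A B insert.IH using insert(1,2)
    by (simp add: sqdev_def power2_eq_square algebra_simps)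
  finally show ?case .
qed

lemma sqdev_ge: "0 \<le> x \<Longrightarrow> x \<le> 1 \<Longrightarrow> 0 \<le> u \<Longrightarrow> (u * x - c)\<^sup>2 \<le> sqdev c x u"
  by (simp add: sqdev_def)

lemma sqdev_nonneg: "0 \<le> x \<Longrightarrow> x \<le> 1 \<Longrightarrow> 0 \<le> u \<Longrightarrow> 0 \<le> sqdev c x u"
  by (simp add: sqdev_def)

text \<open>Stopping rule of the backward inductions: once the mean \<open>u * x\<close> is off by
  \<open>d\<close>, the quadratic bound is trivially valid for a probability.\<close>

lemma one_le_sqdev:
  assumes "0 \<le> x" "x \<le> 1" "0 \<le> u" "0 < d" "d \<le> \<bar>u * x - c\<bar>"
  shows "1 \<le> sqdev c x u / d\<^sup>2"
proof -
  have "d\<^sup>2 \<le> (u * x - c)\<^sup>2"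
    using assms by (metis abs_le_square_iff abs_of_pos)
  then show ?thesis
    using sqdev_ge[OF assms(1-3), of c] assms(4) by (simp add: field_simps)
qed

text \<open>Centring at the mean leaves only the variance, whose factor
  \<open>1 - (1 - p) ^ m\<close> is controlled by Bernoulli's inequality.\<close>

lemma sqdev_centre_le:
  assumes "0 \<le> p" "p \<le> 1" "0 \<le> u" "u \<le> n"
  shows "sqdev (u * (1 - p) ^ m) ((1 - p) ^ m) u \<le> n * (real m * p)"
proof -
  have "1 - real m * p \<le> (1 - p) ^ m"
    using Bernoulli_inequality[of "- p" m] assms by simp
  moreover have "0 \<le> (1 - p) ^ m" "(1 - p) ^ m \<le> 1"
    using assms by (auto intro: power_le_one)
  moreover from this have "u * (1 - p) ^ m \<le> n * 1"
    using assms by (intro mult_mono) auto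
  ultimately have "u * (1 - p) ^ m \<le> n" "1 - (1 - p) ^ m \<le> real m * p" "0 \<le> 1 - (1 - p) ^ m"
    by auto
  then show ?thesis
    using assms by (auto simp: sqdev_def intro!: mult_mono)
qed

subsection \<open>Reachability\<close>

definition reach :: "'a set set \<Rightarrow> 'a set \<Rightarrow> 'a set" where
  "reach E A = {(x, y). {x, y} \<in> E}\<^sup>* `` A"

lemma reach_empty [simp]: "reach E {} = {}"
  by (simp add: reach_def)

lemma reach_mono: "E \<subseteq> E' \<Longrightarrow> A \<subseteq> A' \<Longrightarrow> reach E A \<subseteq> reach E' A'"
  unfolding reach_def by (intro Image_mono rtrancl_mono) auto

lemma subset_reach: "A \<subseteq> reach E A"
  by (auto simp: reach_def)

lemma reach_step: "x \<in> reach E A \<Longrightarrow> {x, y} \<in> E \<Longrightarrow> y \<in> reach E A"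
  unfolding reach_def by (auto intro: rtrancl_into_rtrancl)

lemma reach_least:
  assumes "A \<subseteq> S" "\<And>x y. x \<in> S \<Longrightarrow> {x, y} \<in> E \<Longrightarrow> y \<in> S"
  shows "reach E A \<subseteq> S"
proof -
  have "y \<in> S" if "(x, y) \<in> {(x, y). {x, y} \<in> E}\<^sup>*" "x \<in> A" for x y
    using that by (induction rule: rtrancl_induct) (use assms in auto)
  then show ?thesis by (auto simp: reach_def)
qed

lemma reach_trans: "A \<subseteq> reach E B \<Longrightarrow> reach E A \<subseteq> reach E B"
  by (rule reach_least) (auto intro: reach_step)

lemma reach_sym:
  assumes "y \<in> reach E {x}"
  shows "x \<in> reach E {y}"
proof -
  have "sym {(x, y). {x, y} \<in> E}"
    by (auto simp: sym_def insert_commute)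
  then have "sym ({(x, y). {x, y} \<in> E}\<^sup>*)"
    by (rule sym_rtrancl)
  then show ?thesis
    using assms by (auto simp: reach_def sym_def)
qed

section \<open>Components and \<open>L1\<close> in terms of \<open>reach\<close>\<close>

lemma finite_all_edges: "finite V \<Longrightarrow> finite (all_edges V)"
  by (simp add: all_edges_def)

lemma doubleton_in_all_edges: "{x, y} \<in> all_edges V \<longleftrightarrow> x \<in> V \<and> y \<in> V \<and> x \<noteq> y"
  by (auto simp: all_edges_def card_insert_if)

lemma reach_subset:
  assumes "E \<subseteq> all_edges V" "A \<subseteq> V"
  shows "reach E A \<subseteq> V"
  using assms by (intro reach_least) (auto simp: doubleton_in_all_edges dest!: subsetD[of E])

lemma joined_Image_eq_reach:
  assumes "E \<subseteq> all_edges V" "x \<in> V"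
  shows "joined V E `` {x} = reach E {x}"
  using assms reach_subset[of E V "{x}"] by (auto simp: joined_def reach_def)

lemma components_eq_reach:
  assumes "E \<subseteq> all_edges V"
  shows "components V E = (\<lambda>x. reach E {x}) ` V"
  using joined_Image_eq_reach[OF assms] by (auto simp: components_def quotient_def)

lemma card_reach_le_L1:
  assumes "finite V" "E \<subseteq> all_edges V" "x \<in> V"
  shows "card (reach E {x}) \<le> L1 V E"
  using assms by (auto simp: L1_def components_eq_reach)

lemma L1_witness:
  assumes "finite V" "V \<noteq> {}" "E \<subseteq> all_edges V"
  obtains x where "x \<in> V" "L1 V E = card (reach E {x})"
proof -
  have "L1 V E \<in> card ` components V E"
    unfolding L1_def using assms by (intro Max_in) (auto simp: components_eq_reach)
  then show ?thesis
    using that assms by (auto simp: components_eq_reach)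
qed

text \<open>Exploring \<open>v\<close>: neighbours in \<open>A\<close> are active already, so only
  those in \<open>N'\<close> have to be added when \<open>v\<close> is removed.\<close>

lemma reach_add_vertex_subset:
  assumes "E \<subseteq> all_edges (V - {v})" "N \<subseteq> N' \<union> A"
  shows "reach (E \<union> (\<lambda>w. {v, w}) ` N) A \<subseteq> insert v (reach E (A - {v} \<union> N'))"
proof (rule reach_least)
  show "A \<subseteq> insert v (reach E (A - {v} \<union> N'))"
    using subset_reach[of "A - {v} \<union> N'" E] by blast
next
  fix x y assume x: "x \<in> insert v (reach E (A - {v} \<union> N'))"
    and e: "{x, y} \<in> E \<union> (\<lambda>w. {v, w}) ` N"
  have N: "N \<subseteq> insert v (reach E (A - {v} \<union> N'))"
    using assms(2) subset_reach[of "A - {v} \<union> N'" E] by blast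
  from e show "y \<in> insert v (reach E (A - {v} \<union> N'))"
  proof (rule UnE)
    assume xy: "{x, y} \<in> E"
    with assms(1) have "{x, y} \<in> all_edges (V - {v})" by (rule subsetD)
    then have "x \<in> reach E (A - {v} \<union> N')"
      using x by (simp add: doubleton_in_all_edges)
    from reach_step[OF this xy] show ?thesis by (rule insertI2)
  next
    assume "{x, y} \<in> (\<lambda>w. {v, w}) ` N"
    then have "y = v \<or> y \<in> N" by (auto simp: doubleton_eq_iff)
    then show ?thesis using N by blast
  qed
qed

text \<open>Converse inclusion for an active \<open>v\<close>. Neighbours of \<open>v\<close> may be
  left out of \<open>A'\<close>, as will happen with reserved vertices.\<close>

lemma reach_add_vertex_supset:
  assumes "v \<in> A" "A' \<subseteq> A \<union> N"
  shows "insert v (reach E A') \<subseteq> reach (E \<union> (\<lambda>w. {v, w}) ` N) A" (is "_ \<subseteq> reach ?E A")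
proof -
  have "reach E A' \<subseteq> reach ?E A'"
    by (rule reach_mono) auto
  moreover have v: "v \<in> reach ?E A"
    using assms(1) subset_reach by fast
  moreover have "A' \<subseteq> reach ?E A"
  proof
    fix w assume "w \<in> A'"
    with assms(2) consider "w \<in> A" | "w \<in> N" by auto
    then show "w \<in> reach ?E A"
    proof cases
      case 1
      then show ?thesis using subset_reach by fast
    next
      case 2
      then show ?thesis using v by (intro reach_step[OF v]) auto
    qed
  qed
  ultimately show ?thesis using reach_trans by blast
qed

lemma notin_reach:
  assumes "E \<subseteq> all_edges (V - {v})" "v \<notin> A"
  shows "v \<notin> reach E A"
proof -
  have "reach E A \<subseteq> - {v}"
    using assms by (intro reach_least) (auto simp: doubleton_in_all_edges dest!: subsetD[of E])
  then show ?thesis by auto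
qed

subsection \<open>Exploration of the random graph\<close>

definition random_graph :: "real \<Rightarrow> 'a set \<Rightarrow> 'a set set pmf" where
  "random_graph p V = random_subset p (all_edges V)"

lemma set_pmf_random_graph: "finite V \<Longrightarrow> E \<in> set_pmf (random_graph p V) \<Longrightarrow> E \<subseteq> all_edges V"
  using set_pmf_random_subset[OF finite_all_edges] by (fastforce simp: random_graph_def)

lemma finite_set_pmf_random_graph: "finite V \<Longrightarrow> finite (set_pmf (random_graph p V))"
  by (simp add: random_graph_def finite_set_pmf_random_subset finite_all_edges)

text \<open>Edges from \<open>v\<close> into \<open>U\<close>, edges from \<open>v\<close> elsewhere
  and edges avoiding \<open>v\<close> form disjoint sets, hence are independent. \<open>U\<close>
  will be the undiscovered set.\<close>

lemma random_graph_expose_vertex: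
  assumes V: "finite V" "v \<in> V" and U: "U \<subseteq> V - {v}"
  shows "random_graph p V = random_subset p U \<bind> (\<lambda>N. random_subset p (V - {v} - U) \<bind>
    (\<lambda>M. map_pmf (\<lambda>E. E \<union> (\<lambda>w. {v, w}) ` (N \<union> M)) (random_graph p (V - {v}))))"
proof -
  let ?f = "\<lambda>w. {v, w}"
  have fin: "finite U" "finite (V - {v} - U)" "finite (all_edges (V - {v}))"
    using V U by (auto intro: finite_subset finite_all_edges)
  have inj: "inj_on ?f X" for X
    by (auto simp: inj_on_def doubleton_eq_iff)
  have "all_edges V = ?f ` U \<union> (?f ` (V - {v} - U) \<union> all_edges (V - {v}))"
  proof (intro subset_antisym subsetI)
    fix e assume e: "e \<in> all_edges V"
    then obtain x y where xy: "e = {x, y}"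
      by (auto simp: all_edges_def card_2_iff)
    with e have "x \<in> V" "y \<in> V" "x \<noteq> y" by (auto simp: doubleton_in_all_edges)
    then show "e \<in> ?f ` U \<union> (?f ` (V - {v} - U) \<union> all_edges (V - {v}))"
      unfolding xy using U by (cases "x = v"; cases "y = v")
        (auto simp: doubleton_in_all_edges insert_commute)
  next
    fix e assume "e \<in> ?f ` U \<union> (?f ` (V - {v} - U) \<union> all_edges (V - {v}))"
    then show "e \<in> all_edges V"
      using V U by (auto simp: doubleton_in_all_edges) (auto simp: all_edges_def)
  qed
  moreover have "?f ` U \<inter> (?f ` (V - {v} - U) \<union> all_edges (V - {v})) = {}"
    "?f ` (V - {v} - U) \<inter> all_edges (V - {v}) = {}"
    by (auto simp: doubleton_eq_iff doubleton_in_all_edges)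
  moreover have "E \<union> ?f ` (N \<union> M) = ?f ` N \<union> (?f ` M \<union> E)" for N M E
    by auto
  ultimately show ?thesis
    unfolding random_graph_def
    by (simp add: fin random_subset_Un random_subset_image inj bind_map_pmf map_bind_pmf
        pmf.map_comp o_def)
qed

text \<open>One step of the backward induction: the later bound is averaged over \<open>N\<close> by
  \<open>expectation_sqdev\<close>, while \<open>M\<close> drops out because \<open>Q\<close> does
  not depend on it.\<close>

lemma prob_expose_vertex_le:
  assumes p: "0 \<le> p" "p \<le> 1" and V: "finite V" "v \<in> V" and U: "U \<subseteq> V - {v}"
    and bound: "\<And>N. N \<subseteq> U \<Longrightarrow>
      measure_pmf.prob (random_graph p (V - {v})) {E. Q N E} \<le> sqdev c x (card (U - N)) / d"
    and imp: "\<And>N M E. N \<subseteq> U \<Longrightarrow> M \<subseteq> V - {v} - U \<Longrightarrow> E \<subseteq> all_edges (V - {v}) \<Longrightarrow>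
      P (E \<union> (\<lambda>w. {v, w}) ` (N \<union> M)) \<Longrightarrow> Q N E"
  shows "measure_pmf.prob (random_graph p V) {E. P E} \<le> sqdev c ((1 - p) * x) (card U) / d"
proof -
  let ?G = "random_graph p (V - {v})" and ?W = "V - {v} - U"
  have fin: "finite U" "finite ?W" "finite (V - {v})"
    using V U by (auto intro: finite_subset)
  note fin_pmf = fin[THEN finite_set_pmf_random_subset] finite_set_pmf_random_graph[OF fin(3)]
  have 1: "measure_pmf.prob (map_pmf (\<lambda>E. E \<union> (\<lambda>w. {v, w}) ` (N \<union> M)) ?G) {E. P E}
      \<le> measure_pmf.prob ?G {E. Q N E}" if "N \<subseteq> U" "M \<subseteq> ?W" for N M
    unfolding measure_map_pmf
    by (rule measure_pmf.finite_measure_mono_AE)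
       (use that imp set_pmf_random_graph[OF fin(3)] in \<open>auto simp: AE_measure_pmf_iff\<close>)
  have 2: "measure_pmf.prob (random_subset p ?W \<bind>
      (\<lambda>M. map_pmf (\<lambda>E. E \<union> (\<lambda>w. {v, w}) ` (N \<union> M)) ?G)) {E. P E}
      \<le> sqdev c x (card (U - N)) / d" if "N \<subseteq> U" for N
  proof -
    have "measure_pmf.prob (random_subset p ?W \<bind>
        (\<lambda>M. map_pmf (\<lambda>E. E \<union> (\<lambda>w. {v, w}) ` (N \<union> M)) ?G)) {E. P E}
      \<le> measure_pmf.expectation (random_subset p ?W) (\<lambda>M. measure_pmf.prob ?G {E. Q N E})"
      using set_pmf_random_subset[OF fin(2), of p] that fin_pmf
      by (intro prob_bind_pmf_le 1) auto
    also have "\<dots> \<le> sqdev c x (card (U - N)) / d"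
      using bound[OF that] by simp
    finally show ?thesis .
  qed
  have "measure_pmf.prob (random_graph p V) {E. P E}
      \<le> measure_pmf.expectation (random_subset p U) (\<lambda>N. sqdev c x (card (U - N)) / d)"
    unfolding random_graph_expose_vertex[OF V U]
    using set_pmf_random_subset[OF fin(1), of p] fin_pmf
    by (intro prob_bind_pmf_le 2) auto
  also have "\<dots> = sqdev c ((1 - p) * x) (card U) / d"
    using expectation_sqdev[OF fin(1) p] by simp
  finally show ?thesis .
qed

text \<open>A reach of \<open>j\<close> vertices keeps the exploration alive for \<open>j\<close>
  steps, after which at most \<open>card V - j\<close>, hence at most \<open>c - d\<close>, vertices
  are undiscovered: a deviation of \<open>d\<close>. Each step lowers both \<open>card V\<close> and
  \<open>j\<close> by one, so this condition persists.\<close>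

lemma prob_card_reach_ge:
  assumes p: "0 \<le> p" "p \<le> 1" and "d > 0"
    and "finite V" "A \<subseteq> V" "real (card V) - real j \<le> c - d"
  shows "measure_pmf.prob (random_graph p V) {E. j \<le> card (reach E A)}
    \<le> sqdev c ((1 - p) ^ j) (card (V - A)) / d\<^sup>2"
  using assms(4-)
proof (induction j arbitrary: V A)
  case 0
  have "card (V - A) \<le> card V" by (simp add: 0 card_mono)
  then have "1 \<le> sqdev c 1 (card (V - A)) / d\<^sup>2"
    using 0 \<open>d > 0\<close> by (intro one_le_sqdev) auto
  then show ?case
    using order_trans[OF measure_pmf.prob_le_1] by simp
next
  case (Suc j)
  show ?case
  proof (cases "A = {}")
    case True
    then show ?thesis
      using p by (auto intro!: divide_nonneg_nonneg sqdev_nonneg mult_le_one power_le_one)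
  next
    case False
    then obtain v where v: "v \<in> A" by auto
    have *: "V - {v} - (A - {v} \<union> N) = V - A - N" for N
      using v by auto
    have "measure_pmf.prob (random_graph p V) {E. Suc j \<le> card (reach E A)}
        \<le> sqdev c ((1 - p) * (1 - p) ^ j) (card (V - A)) / d\<^sup>2"
    proof (rule prob_expose_vertex_le[where v = v and
          Q = "\<lambda>N E. j \<le> card (reach E (A - {v} \<union> N))"])
      fix N assume "N \<subseteq> V - A"
      moreover have "card V > 0" using v Suc.prems by (auto simp: card_gt_0_iff)
      ultimately show "measure_pmf.prob (random_graph p (V - {v}))
          {E. j \<le> card (reach E (A - {v} \<union> N))} \<le> sqdev c ((1 - p) ^ j) (card (V - A - N)) / d\<^sup>2"
        unfolding *[symmetric] using v Suc.prems by (intro Suc.IH) (auto simp: card_Diff_singleton_if)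
    next
      fix N M E assume NM: "N \<subseteq> V - A" "M \<subseteq> V - {v} - (V - A)" and E: "E \<subseteq> all_edges (V - {v})"
        and j: "Suc j \<le> card (reach (E \<union> (\<lambda>w. {v, w}) ` (N \<union> M)) A)"
      let ?R = "reach E (A - {v} \<union> N)"
      have "?R \<subseteq> V - {v}"
        using E Suc.prems NM v by (intro reach_subset) auto
      then have "finite ?R" using Suc.prems finite_subset by blast
      moreover have "reach (E \<union> (\<lambda>w. {v, w}) ` (N \<union> M)) A \<subseteq> insert v ?R"
        using E NM by (intro reach_add_vertex_subset) auto
      ultimately have "Suc j \<le> card (insert v ?R)"
        using j by (meson card_mono finite_insert order_trans)
      then show "j \<le> card ?R"
        using \<open>finite ?R\<close> by (simp add: card_insert_if split: if_splits)
    qed (use p v Suc.prems in auto)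
    then show ?thesis by simp
  qed
qed

text \<open>
  The state of the exploration after \<open>m - j\<close> steps: \<open>V\<close> are the unexplored vertices, \<open>A\<close> the active ones,
  \<open>B\<close> the reserved starting points, and \<open>s\<close> counts the explored vertices of the current component. The
  hypothesis \<open>m \<le> s + m\<^sub>0 + j\<close> says that this component was started at time \<open>m\<^sub>0\<close> at the latest. Edges from an
  explored vertex to \<open>B\<close> are ignored, which can only make the components smaller.
\<close>

lemma prob_all_components_small:
  fixes m m\<^sub>0 b n l :: nat
  assumes p: "0 \<le> p" "p \<le> 1" and "d > 0" and lm: "l + m\<^sub>0 \<le> m"
    and dev: "\<And>j u. j \<le> m \<Longrightarrow> \<bar>real u * (1 - p) ^ j - c\<bar> < d \<Longrightarrow> m + u < n + j"
    and dev': "\<And>j u. j + m\<^sub>0 \<le> m \<Longrightarrow> \<bar>real u * (1 - p) ^ j - c\<bar> < d \<Longrightarrow> m + u + b < n + j"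
    and "finite V" "A \<subseteq> V" "B \<subseteq> V" "A \<inter> B = {}" "card B \<le> b" "j \<le> m" "card V + m = n + j"
      "m \<le> s + m\<^sub>0 + j"
  shows "measure_pmf.prob (random_graph p V)
      {E. s + card (reach E A) < l \<and> (\<forall>x\<in>V. card (reach E {x}) < l)}
    \<le> sqdev c ((1 - p) ^ j) (card (V - A - B)) / d\<^sup>2"
  using assms(7-)
proof (induction j arbitrary: V A B s)
  case 0
  \<comment> \<open>The current component has been explored since time \<open>m\<^sub>0\<close> at
    the latest, so it already has \<open>l\<close> vertices and the event is empty.\<close>
  then have "s \<ge> l" using lm by simp
  then show ?case
    by (auto intro!: divide_nonneg_nonneg sqdev_nonneg)
next
  case (Suc j)
  have q: "0 \<le> (1 - p) ^ Suc j" "(1 - p) ^ Suc j \<le> 1"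
    using p by (auto intro!: mult_le_one power_le_one simp del: power_Suc)
  \<comment> \<open>Stated for arbitrary \<open>A'\<close>, \<open>B'\<close>, \<open>s'\<close> to
    cover both continuing the current component and restarting from a reserved vertex.\<close>
  have active: "measure_pmf.prob (random_graph p V)
      {E. s' + card (reach E A') < l \<and> (\<forall>x\<in>V. card (reach E {x}) < l)}
      \<le> sqdev c ((1 - p) * (1 - p) ^ j) (card (V - A' - B')) / d\<^sup>2"
    if v: "v \<in> A'" and A': "A' \<subseteq> V" and B': "B' \<subseteq> V" "A' \<inter> B' = {}" "card B' \<le> b"
      and s': "m \<le> s' + m\<^sub>0 + Suc j" for v A' B' s'
  proof (rule prob_expose_vertex_le[where v = v and
      Q = "\<lambda>N E. Suc s' + card (reach E (A' - {v} \<union> N)) < l \<and> (\<forall>x\<in>V-{v}. card (reach E {x}) < l)"])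
    fix N assume N: "N \<subseteq> V - A' - B'"
    have *: "V - A' - B' - N = V - {v} - (A' - {v} \<union> N) - B'"
      using v by auto
    have "card V > 0" using v A' Suc.prems by (auto simp: card_gt_0_iff)
    then show "measure_pmf.prob (random_graph p (V - {v}))
       {E. Suc s' + card (reach E (A' - {v} \<union> N)) < l \<and> (\<forall>x\<in>V-{v}. card (reach E {x}) < l)}
       \<le> sqdev c ((1 - p) ^ j) (card (V - A' - B' - N)) / d\<^sup>2"
      unfolding * using v A' B' s' N Suc.prems
      by (intro Suc.IH) (auto simp: card_Diff_singleton_if)
  next
    fix N M E assume N: "N \<subseteq> V - A' - B'" and M: "M \<subseteq> V - {v} - (V - A' - B')"
      and E: "E \<subseteq> all_edges (V - {v})"
    let ?F = "E \<union> (\<lambda>w. {v, w}) ` (N \<union> M)"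
    assume small: "s' + card (reach ?F A') < l \<and> (\<forall>x\<in>V. card (reach ?F {x}) < l)"
    have F: "?F \<subseteq> all_edges V"
      using E N M v A' by (auto simp: doubleton_in_all_edges) (auto simp: all_edges_def)
    have fin: "finite (reach ?F X)" if "X \<subseteq> V" for X
      using reach_subset[OF F that] Suc.prems finite_subset by blast
    let ?R = "reach E (A' - {v} \<union> N)"
    have R: "insert v ?R \<subseteq> reach ?F A'"
      using v by (intro reach_add_vertex_supset) auto
    then have "card (insert v ?R) \<le> card (reach ?F A')"
      using A' fin by (intro card_mono) auto
    moreover have "v \<notin> ?R"
      using E v N A' by (intro notin_reach) auto
    moreover have "finite ?R"
      by (rule finite_subset[OF _ fin[OF A']]) (use R in simp)
    ultimately have "Suc s' + card ?R < l"
      using conjunct1[OF small] by simp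
    moreover have "card (reach E {x}) < l" if "x \<in> V - {v}" for x
    proof -
      have "card (reach E {x}) \<le> card (reach ?F {x})"
        using that by (intro card_mono fin reach_mono) auto
      also have "\<dots> < l"
        using conjunct2[OF small] that by blast
      finally show ?thesis .
    qed
    ultimately show "Suc s' + card ?R < l \<and> (\<forall>x\<in>V-{v}. card (reach E {x}) < l)"
      by blast
  qed (use p v A' Suc.prems in auto)
  show ?case
  proof (cases "\<bar>real (card (V - A - B)) * (1 - p) ^ Suc j - c\<bar> < d")
    case False
    then have "1 \<le> sqdev c ((1 - p) ^ Suc j) (card (V - A - B)) / d\<^sup>2"
      using q \<open>d > 0\<close> by (intro one_le_sqdev) auto
    then show ?thesis
      using order_trans[OF measure_pmf.prob_le_1] by blast
  next
    case close: True
    show ?thesis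
    proof (cases "A = {}")
      case False
      then obtain v where "v \<in> A" by auto
      then show ?thesis
        using active[of v A B s] Suc.prems by simp
    next
      case True
      have cardV: "card V = card (V - A - B) + card B"
        using Suc.prems True
        by (metis Diff_empty card_Diff_subset card_mono finite_subset le_add_diff_inverse2)
      \<comment> \<open>Without active vertices, \<open>V\<close> consists of undiscovered vertices
        and at most \<open>b\<close> reserved ones. By \<open>dev'\<close> this cannot happen from
        time \<open>m\<^sub>0\<close> on, so a restart with count 0 is admissible.\<close>
      have "\<not> Suc j + m\<^sub>0 \<le> m"
        using dev'[OF _ close] cardV Suc.prems by auto
      \<comment> \<open>By \<open>dev\<close> there are fewer undiscovered vertices than
        \<open>card V\<close>, so the reserve is not exhausted.\<close>
      moreover have "B \<noteq> {}"
        using dev[OF _ close] cardV Suc.prems by auto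
      then obtain v where v: "v \<in> B" by auto
      have "card (B - {v}) \<le> b"
        using Suc.prems card_Diff1_le[of B v] by linarith
      moreover have "V - {v} - (B - {v}) = V - A - B"
        using v True by auto
      ultimately have "measure_pmf.prob (random_graph p V)
          {E. 0 + card (reach E {v}) < l \<and> (\<forall>x\<in>V. card (reach E {x}) < l)}
        \<le> sqdev c ((1 - p) ^ Suc j) (card (V - A - B)) / d\<^sup>2"
        using active[of v "{v}" "B - {v}" 0] Suc.prems v by auto
      \<comment> \<open>The component of the new starting point is among those required to be
        smaller than \<open>l\<close>.\<close>
      moreover have "measure_pmf.prob (random_graph p V)
          {E. s + card (reach E A) < l \<and> (\<forall>x\<in>V. card (reach E {x}) < l)}
        \<le> measure_pmf.prob (random_graph p V)
          {E. 0 + card (reach E {v}) < l \<and> (\<forall>x\<in>V. card (reach E {x}) < l)}"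
        using v Suc.prems by (intro measure_pmf.finite_measure_mono) auto
      ultimately show ?thesis by linarith
    qed
  qed
qed

text \<open>The exploration starts with no active and \<open>b\<close> reserved vertices. The
  conditions \<open>dev\<close> and \<open>dev'\<close> concern only the mean number
  \<open>(n - b) * (1 - p) ^ k\<close> of undiscovered vertices, with \<open>2 * d\<close> as room
  for deviations.\<close>

lemma prob_L1_lt:
  fixes b m m\<^sub>0 l :: nat and V :: "'a set"
  defines "n \<equiv> card V"
  assumes p: "0 \<le> p" "p \<le> 1" and "d > 0" and V: "finite V" "V \<noteq> {}"
    and "b \<le> n" "l + m\<^sub>0 \<le> m" and half: "1 / 2 \<le> (1 - p) ^ m"
    and dev: "\<And>k. k \<le> m \<Longrightarrow> real k + (real n - b) * (1 - p) ^ k + 2 * d \<le> n"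
    and dev': "\<And>k. m\<^sub>0 \<le> k \<Longrightarrow> k \<le> m \<Longrightarrow> real k + (real n - b) * (1 - p) ^ k + 2 * d + b \<le> n"
  shows "measure_pmf.prob (random_graph p V) {E. L1 V E < l} \<le> n * (real m * p) / d\<^sup>2"
proof -
  let ?c = "(real n - b) * (1 - p) ^ m"
  obtain B where B: "B \<subseteq> V" "card B = b"
    using \<open>b \<le> n\<close> obtain_subset_with_card_n unfolding n_def by metis
  \<comment> \<open>The martingale controls \<open>u * (1 - p) ^ j\<close>; by \<open>half\<close>,
    undoing the scaling at most doubles the deviation.\<close>
  have close: "real u < (real n - b) * (1 - p) ^ (m - j) + 2 * d"
    if "j \<le> m" "\<bar>real u * (1 - p) ^ j - ?c\<bar> < d" for j u
  proof -
    have "(1 - p) ^ m \<le> (1 - p) ^ j"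
      using p that by (intro power_decreasing) auto
    then have q: "1 / 2 \<le> (1 - p) ^ j"
      using half by linarith
    have "real u * (1 - p) ^ j < ((real n - b) * (1 - p) ^ (m - j)) * (1 - p) ^ j + d"
      using that by (simp add: mult.assoc flip: power_add)
    also have "d \<le> 2 * d * (1 - p) ^ j"
      using mult_left_mono[OF q, of "2 * d"] \<open>d > 0\<close> by simp
    finally have "real u * (1 - p) ^ j < ((real n - b) * (1 - p) ^ (m - j) + 2 * d) * (1 - p) ^ j"
      by (simp add: algebra_simps)
    then show ?thesis
      by (rule mult_right_less_imp_less) (use q in linarith)
  qed
  have "measure_pmf.prob (random_graph p V) {E. L1 V E < l} \<le> measure_pmf.prob (random_graph p V)
      {E. 0 + card (reach E {}) < l \<and> (\<forall>x\<in>V. card (reach E {x}) < l)}"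
    using set_pmf_random_graph[OF V(1)]
    by (intro measure_pmf.finite_measure_mono_AE)
      (auto simp: AE_measure_pmf_iff dest: card_reach_le_L1[OF V(1)] intro: le_less_trans)
  also have "\<dots> \<le> sqdev ?c ((1 - p) ^ m) (card (V - {} - B)) / d\<^sup>2"
  proof (rule prob_all_components_small[where m\<^sub>0 = m\<^sub>0 and b = b and n = n and m = m])
    fix j u assume j: "j \<le> m" and u: "\<bar>real u * (1 - p) ^ j - ?c\<bar> < d"
    show "m + u < n + j"
      using close[OF j u] dev[of "m - j"] j by (simp add: of_nat_diff)
  next
    fix j u assume j: "j + m\<^sub>0 \<le> m" and u: "\<bar>real u * (1 - p) ^ j - ?c\<bar> < d"
    show "m + u + b < n + j"
      using close[OF _ u] dev'[of "m - j"] j le_diff_conv2[of j m m\<^sub>0]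
      by (simp add: of_nat_diff add.commute)
  qed (use assms B in auto)
  also have "card (V - {} - B) = n - b"
    using B V by (simp add: n_def card_Diff_subset finite_subset)
  also have "sqdev ?c ((1 - p) ^ m) (n - b) \<le> n * (real m * p)"
    using sqdev_centre_le[of p "real (n - b)" n m] p \<open>b \<le> n\<close> by (simp add: of_nat_diff)
  finally show ?thesis
    by (simp add: divide_right_mono)
qed

text \<open>
  Averaging over all tuples in \<open>V\<^sup>a\<close>: a tuple that meets a largest component has a reach of at least
  \<open>L1 V E\<close> vertices, and at most \<open>(card V - j) ^ a\<close> tuples miss a component with at least \<open>j\<close> vertices.
\<close>

lemma prob_L1_ge:
  assumes V: "finite V" "V \<noteq> {}"
    and bound: "\<And>A. A \<subseteq> V \<Longrightarrow> card A \<le> a \<Longrightarrow>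
      measure_pmf.prob (random_graph p V) {E. j \<le> card (reach E A)} \<le> e"
  shows "measure_pmf.prob (random_graph p V) {E. j \<le> L1 V E} \<le> e + (real (card V - j) / card V) ^ a"
proof -
  let ?M = "random_graph p V"
  define T where "T = {xs. set xs \<subseteq> V \<and> length xs = a}"
  have T: "finite T" "card T = card V ^ a"
    unfolding T_def using V by (auto simp: finite_lists_length_eq card_lists_length_eq)
  note finM = finite_set_pmf_random_graph[OF V(1), of p]
  have pointwise: "real (card V) ^ a * indicator {E. j \<le> L1 V E} E
      \<le> (\<Sum>xs\<in>T. indicator {E. j \<le> card (reach E (set xs))} E) + real (card V - j) ^ a"
    if "E \<in> set_pmf ?M" for E
  proof (cases "j \<le> L1 V E")
    case True
    have E: "E \<subseteq> all_edges V"
      using set_pmf_random_graph[OF V(1) that] .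
    obtain x where x: "x \<in> V" "L1 V E = card (reach E {x})"
      using L1_witness[OF V E] .
    let ?C = "reach E {x}"
    have C: "?C \<subseteq> V" using x E by (intro reach_subset) auto
    define H where "H = {xs\<in>T. set xs \<inter> ?C \<noteq> {}}"
    have "T - H = {xs. set xs \<subseteq> V - ?C \<and> length xs = a}"
      unfolding H_def T_def by auto
    then have "card (T - H) = (card V - card ?C) ^ a"
      using V C by (simp add: card_lists_length_eq card_Diff_subset finite_subset)
    also have "\<dots> \<le> (card V - j) ^ a"
      using True x by (intro power_mono) auto
    finally have "card V ^ a \<le> card H + (card V - j) ^ a"
      using T by (subst (asm) card_Diff_subset) (auto simp: H_def)
    moreover have "real (card H) = (\<Sum>xs\<in>H. indicator {E. j \<le> card (reach E (set xs))} E)"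
    proof -
      have "j \<le> card (reach E (set xs))" if xs: "xs \<in> H" for xs
      proof -
        obtain y where y: "y \<in> set xs" "y \<in> ?C"
          using xs by (auto simp: H_def)
        have "{x} \<subseteq> reach E {y}"
          using reach_sym[OF y(2)] by simp
        then have "?C \<subseteq> reach E {y}"
          by (rule reach_trans)
        also have "\<dots> \<subseteq> reach E (set xs)"
          using y by (intro reach_mono) auto
        finally have "card ?C \<le> card (reach E (set xs))"
          using xs V(1) E by (intro card_mono finite_subset[OF reach_subset]) (auto simp: H_def T_def)
        then show ?thesis using True x by simp
      qed
      then show ?thesis by simp
    qed
    moreover have "(\<Sum>xs\<in>H. indicator {E. j \<le> card (reach E (set xs))} E)
        \<le> (\<Sum>xs\<in>T. indicator {E. j \<le> card (reach E (set xs))} E :: real)"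
      using T by (intro sum_mono2) (auto simp: H_def)
    ultimately show ?thesis
      using True by (simp flip: of_nat_power of_nat_add)
  qed (simp add: sum_nonneg)
  have "real (card V) ^ a * measure_pmf.prob ?M {E. j \<le> L1 V E}
      = measure_pmf.expectation ?M (\<lambda>E. real (card V) ^ a * indicator {E. j \<le> L1 V E} E)"
    by simp
  also have "\<dots> \<le> measure_pmf.expectation ?M
      (\<lambda>E. (\<Sum>xs\<in>T. indicator {E. j \<le> card (reach E (set xs))} E) + real (card V - j) ^ a)"
    using finM pointwise by (rule expectation_mono_pmf)
  also have "\<dots> = (\<Sum>xs\<in>T. measure_pmf.prob ?M {E. j \<le> card (reach E (set xs))}) + real (card V - j) ^ a"
    using finM by (simp add: integrable_measure_pmf_finite)
  also have "\<dots> \<le> real (card V) ^ a * e + real (card V - j) ^ a"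
  proof -
    have "(\<Sum>xs\<in>T. measure_pmf.prob ?M {E. j \<le> card (reach E (set xs))}) \<le> (\<Sum>xs\<in>T. e)"
      by (intro sum_mono bound) (auto simp: T_def card_length)
    then show ?thesis using T by simp
  qed
  finally show ?thesis
    using V by (simp add: power_divide field_simps card_gt_0_iff)
qed

subsection \<open>Asymptotics\<close>

lemma power_one_minus_le:
  fixes p :: real
  assumes "0 \<le> p" "p \<le> 1"
  shows "(1 - p) ^ k \<le> 1 - k * p + k * (real k - 1) / 2 * p\<^sup>2"
proof (induction k)
  case (Suc k)
  have "1 - k * p \<le> (1 - p) ^ k"
    using Bernoulli_inequality[of "- p" k] assms by simp
  then have "p * (1 - k * p) \<le> p * (1 - p) ^ k"
    using assms by (intro mult_left_mono)
  then have "(1 - p) ^ Suc k \<le> (1 - k * p + k * (real k - 1) / 2 * p\<^sup>2) - p * (1 - k * p)"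
    using Suc by (simp add: algebra_simps)
  also have "\<dots> = 1 - Suc k * p + Suc k * (real (Suc k) - 1) / 2 * p\<^sup>2"
    by (simp add: power2_eq_square field_simps)
  finally show ?case .
qed simp

text \<open>Through \<open>(1 - p) ^ Suc k = (1 - p) ^ k - p * (1 - p) ^ k\<close>, each truncation
  of the binomial expansion yields the next: Bernoulli's linear lower bound gave the quadratic upper
  bound, which gives this cubic lower bound.\<close>

lemma power_one_minus_ge:
  fixes p :: real
  assumes "0 \<le> p" "p \<le> 1"
  shows "1 - k * p + k * (real k - 1) / 2 * p\<^sup>2 - k * (real k - 1) * (real k - 2) / 6 * p ^ 3
    \<le> (1 - p) ^ k"
proof (induction k)
  case (Suc k)
  have "p * (1 - p) ^ k \<le> p * (1 - k * p + k * (real k - 1) / 2 * p\<^sup>2)"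
    using assms power_one_minus_le by (intro mult_left_mono)
  then have "(1 - k * p + k * (real k - 1) / 2 * p\<^sup>2 - k * (real k - 1) * (real k - 2) / 6 * p ^ 3)
      - p * (1 - k * p + k * (real k - 1) / 2 * p\<^sup>2) \<le> (1 - p) ^ Suc k"
    using Suc by (simp add: algebra_simps)
  then show ?case
    by (simp add: power2_eq_square power3_eq_cube field_simps)
qed simp

text \<open>In \<open>prob_L1_lt\<close>, \<open>m * p\<close> has order \<open>e\<close> and
  \<open>d\<close> has order \<open>\<eta>\<^sup>2 * e\<^sup>2 * n\<close>, so the error
  \<open>n * (m * p) / d\<^sup>2\<close> has order
  \<open>1 / (\<eta> ^ 4 * e ^ 3 * n)\<close>.\<close>

lemma prob_L1_too_small:
  fixes n :: nat and e \<eta> :: real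
  assumes \<eta>: "0 < \<eta>" "\<eta> \<le> 1 / 2" and e: "0 < e" "28 * e \<le> \<eta>"
    and en: "1 \<le> e\<^sup>2 * n" "2 \<le> \<eta> * e * n"
  shows "measure_pmf.prob (random_graph ((1 + e) / n) {1..n})
      {E. L1 {1..n} E < (2 - 3 * \<eta>) * e * n} \<le> 1024 / (\<eta> ^ 4 * (e ^ 3 * n))"
proof -
  define x where "x = real n"
  define p where "p = (1 + e) / x"
  define b where "b = nat \<lceil>e\<^sup>2 * x\<rceil>"
  define m\<^sub>0 where "m\<^sub>0 = nat \<lceil>\<eta> * e * x\<rceil>"
  define m where "m = nat \<lfloor>(2 - \<eta>) * e * x\<rfloor>"
  \<comment> \<open>\<open>2 * d\<close> is at most \<open>b\<close>, which suffices at early times,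
    and is half the surplus \<open>\<eta>\<^sup>2 * e\<^sup>2 * x / 4\<close> built up by time
    \<open>\<eta> * e * x\<close>, which suffices from \<open>m\<^sub>0\<close> on.\<close>
  define d where "d = \<eta>\<^sup>2 * e\<^sup>2 * x / 16"
  have e1: "e \<le> 1 / 28" using e \<eta> by simp
  have ee: "e\<^sup>2 \<le> e / 28"
    using mult_left_mono[OF e1, of e] e by (simp add: power2_eq_square)
  have x: "0 < x" using en by (cases "n = 0") (auto simp: x_def)
  have ex: "1 \<le> e\<^sup>2 * x" "2 \<le> \<eta> * e * x" using en by (simp_all add: x_def)
  have x1: "2 \<le> x"
  proof -
    have "e\<^sup>2 * x \<le> (1 / 2) * x" using ee e1 x by (intro mult_right_mono) auto
    then show ?thesis using ex by simp
  qed
  have p: "0 \<le> p" "p \<le> 1" using x1 e e1 by (auto simp: p_def field_simps)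
  have b: "e\<^sup>2 * x \<le> b" "b \<le> 2 * e\<^sup>2 * x"
    using ex unfolding b_def by linarith+
  have m\<^sub>0: "\<eta> * e * x \<le> m\<^sub>0" "m\<^sub>0 \<le> \<eta> * e * x + 1"
    using ex unfolding m\<^sub>0_def by linarith+
  have "\<eta> * e * x \<le> (1 / 2) * e * x"
    using \<eta> e x by (intro mult_right_mono) auto
  then have "0 \<le> (2 - \<eta>) * e * x - \<eta> * e * x - 2" using ex by (simp add: algebra_simps)
  have "0 \<le> (2 - \<eta>) * e * x"
    using \<eta> e x by (intro mult_nonneg_nonneg) auto
  then have m: "m \<le> (2 - \<eta>) * e * x" "(2 - \<eta>) * e * x - 1 \<le> m"
    unfolding m_def by linarith+
  have "m\<^sub>0 \<le> m"
    using m\<^sub>0 m \<open>0 \<le> (2 - \<eta>) * e * x - \<eta> * e * x - 2\<close> by linarith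
  have "d > 0" using \<eta> e x by (simp add: d_def)
  \<comment> \<open>In the mean, \<open>k\<close> steps discover more than \<open>k\<close>
    non-reserved vertices. The second-order bound gives the factor \<open>(1 - b / x) * F\<close>,
    and \<open>z \<le> (2 - \<eta>) * e\<close> keeps \<open>F\<close> above 1 by nearly
    \<open>\<eta> * e / 2\<close>.\<close>
  have growth: "k * (1 + \<eta> * e / 4) \<le> (x - b) * (1 - (1 - p) ^ k)" if "k \<le> m" for k :: nat
  proof -
    define z where "z = k / x"
    have z: "0 \<le> z" "z \<le> (2 - \<eta>) * e"
      using m that x by (auto simp: z_def divide_le_eq)
    have bx: "b / x \<le> 2 * e\<^sup>2" using b x by (simp add: divide_le_eq)
    define F where "F = (1 + e) * (1 - z * (1 + e) / 2)"
    have F_eq: "F = 1 + e - z * (1 + e)\<^sup>2 / 2"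
      by (simp add: F_def power2_eq_square field_simps)
    have "z * (1 + e)\<^sup>2 \<le> ((2 - \<eta>) * e) * (1 + 3 * e)"
      using z e e1 ee \<eta> by (intro mult_mono) (auto simp: power2_eq_square algebra_simps)
    also have "\<dots> \<le> 2 * e - \<eta> * e + 6 * e\<^sup>2"
      using \<eta> e by (simp add: algebra_simps power2_eq_square)
    finally have F1: "1 + \<eta> * e / 2 - 3 * e\<^sup>2 \<le> F"
      by (simp add: F_eq)
    have F2: "F \<le> 2"
      using mult_nonneg_nonneg[OF z(1) zero_le_power2[of "1 + e"]] e1 unfolding F_eq by linarith
    have F0: "0 \<le> F"
      using F1 ee e1 mult_nonneg_nonneg[of \<eta> e] \<eta> e by linarith
    \<comment> \<open>The hypothesis \<open>28 * e \<le> \<eta>\<close> absorbs the errors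
      \<open>3 * e\<^sup>2\<close> in \<open>F\<close> and \<open>4 * e\<^sup>2\<close> from the
      reserve.\<close>
    have "7 * e\<^sup>2 \<le> \<eta> * e / 4"
      using mult_right_mono[OF e(2), of e] e by (simp add: power2_eq_square)
    moreover have "b / x * F \<le> 2 * e\<^sup>2 * 2"
      using bx F2 F0 x by (intro mult_mono) auto
    ultimately have "1 + \<eta> * e / 4 \<le> (1 - b / x) * F"
      using F1 by (simp add: algebra_simps)
    then have "k * (1 + \<eta> * e / 4) \<le> k * ((1 - b / x) * F)"
      by (intro mult_left_mono) auto
    also have "\<dots> = (x - b) * (k * p - k * real k / 2 * p\<^sup>2)"
      using x by (simp add: F_def z_def p_def power2_eq_square field_simps)
    also have "\<dots> \<le> (x - b) * (1 - (1 - p) ^ k)"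
    proof (rule mult_left_mono)
      have "k * (real k - 1) / 2 * p\<^sup>2 \<le> k * real k / 2 * p\<^sup>2"
        by (intro mult_right_mono) (auto simp: algebra_simps)
      then show "k * p - k * real k / 2 * p\<^sup>2 \<le> 1 - (1 - p) ^ k"
        using power_one_minus_le[OF p, of k] by linarith
      have "2 * e\<^sup>2 * x \<le> 1 * x"
        using ee e1 x by (intro mult_right_mono) auto
      then show "0 \<le> x - b" using b by linarith
    qed
    finally show ?thesis .
  qed
  have growth': "k + (x - b) * (1 - p) ^ k + k * (\<eta> * e / 4) + b \<le> x" if "k \<le> m" for k :: nat
    using growth[OF that] by (simp add: algebra_simps)
  have d: "2 * d = \<eta> * e * x * (\<eta> * e / 8)"
    by (simp add: d_def power2_eq_square)
  have "measure_pmf.prob (random_graph p {1..n}) {E. L1 {1..n} E < m - m\<^sub>0}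
      \<le> real (card {1..n}) * (real m * p) / d\<^sup>2"
  proof (rule prob_L1_lt[where b = b and m\<^sub>0 = m\<^sub>0])
    show "{1..n} \<noteq> {}" using x by (auto simp: x_def)
    have "2 * e\<^sup>2 * x \<le> 1 * x"
      using ee e1 x by (intro mult_right_mono) auto
    then show "b \<le> card {1..n}" using b x_def by simp
    have "m * p \<le> ((2 - \<eta>) * e * x) * p"
      using m p by (intro mult_right_mono)
    also have "\<dots> = (2 - \<eta>) * (e * (1 + e))"
      using x by (simp add: p_def)
    also have "\<dots> \<le> 2 * (1 / 28 * (1 + 1 / 28))"
      using \<eta> e e1 by (intro mult_mono) auto
    finally have "m * p \<le> 1 / 2" by simp
    then show "1 / 2 \<le> (1 - p) ^ m"
      using Bernoulli_inequality[of "- p" m] p by simp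
  next
    fix k assume k: "k \<le> m"
    have "\<eta> * \<eta> * (e\<^sup>2 * x) \<le> 1 * (e\<^sup>2 * x)"
      using \<eta> x by (intro mult_right_mono mult_le_one) auto
    then have "2 * d \<le> e\<^sup>2 * x"
      using x \<eta> e by (simp add: d_def power2_eq_square)
    moreover have "0 \<le> k * (\<eta> * e / 4)"
      using \<eta> e by simp
    ultimately show "k + (real (card {1..n}) - b) * (1 - p) ^ k + 2 * d \<le> real (card {1..n})"
      using growth'[OF k] b x_def by simp
  next
    fix k assume k: "m\<^sub>0 \<le> k" "k \<le> m"
    then have "\<eta> * e * x \<le> k" using m\<^sub>0 by linarith
    then have "\<eta> * e * x * (\<eta> * e / 8) \<le> k * (\<eta> * e / 4)"
      using \<eta> e x by (intro mult_mono) auto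
    then show "k + (real (card {1..n}) - b) * (1 - p) ^ k + 2 * d + b \<le> real (card {1..n})"
      using growth'[OF k(2)] d unfolding card_atLeastAtMost diff_Suc_1 x_def[symmetric] by linarith
  qed (use p \<open>d > 0\<close> \<open>m\<^sub>0 \<le> m\<close> in auto)
  also have "\<dots> \<le> 1024 / (\<eta> ^ 4 * (e ^ 3 * x))"
  proof -
    have "(2 - \<eta>) * e * x \<le> 2 * e * x"
      using \<eta> e x by (intro mult_right_mono) auto
    then have "m \<le> 2 * e * x"
      using m by linarith
    then have "m * (1 + e) \<le> (2 * e * x) * 2"
      using e e1 x by (intro mult_mono) auto
    then have "m * (1 + e) / d\<^sup>2 \<le> (2 * e * x) * 2 / d\<^sup>2"
      by (intro divide_right_mono) auto
    also have "\<dots> = 1024 / (\<eta> ^ 4 * (e ^ 3 * x))"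
      using \<eta> e x by (simp add: d_def field_simps eval_nat_numeral)
    also have "m * (1 + e) = real (card {1..n}) * (real m * p)"
      using x by (simp add: p_def x_def)
    finally show ?thesis .
  qed
  finally have "measure_pmf.prob (random_graph p {1..n}) {E. L1 {1..n} E < m - m\<^sub>0}
      \<le> 1024 / (\<eta> ^ 4 * (e ^ 3 * x))" .
  \<comment> \<open>Rounding \<open>m\<close> and \<open>m\<^sub>0\<close> loses at most 2, which
    the third \<open>\<eta>\<close> pays for.\<close>
  moreover have "(2 - 3 * \<eta>) * e * x \<le> real (m - m\<^sub>0)"
    using m m\<^sub>0 ex \<open>m\<^sub>0 \<le> m\<close> by (simp add: of_nat_diff algebra_simps)
  then have "measure_pmf.prob (random_graph p {1..n}) {E. L1 {1..n} E < (2 - 3 * \<eta>) * e * x}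
      \<le> measure_pmf.prob (random_graph p {1..n}) {E. L1 {1..n} E < m - m\<^sub>0}"
    by (intro measure_pmf.finite_measure_mono) auto
  ultimately show ?thesis
    by (simp add: p_def x_def)
qed

text \<open>For a fixed small \<open>A\<close>, a reach of \<open>j\<close> vertices forces a
  deviation of \<open>d\<close>. Tuples missing a large component have proportion at most
  \<open>exp (- (a * (j / n)))\<close>, where \<open>a * (j / n)\<close> is at least
  \<open>\<delta> / 2 * (e ^ 3 * n)\<close>.\<close>

lemma prob_L1_too_large:
  fixes n :: nat and e \<delta> :: real
  assumes \<delta>: "0 < \<delta>" "\<delta> \<le> 1" and e: "0 < e" "28 * e \<le> \<delta>" and en: "8 \<le> \<delta> * e\<^sup>2 * n"
  shows "measure_pmf.prob (random_graph ((1 + e) / n) {1..n})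
      {E. L1 {1..n} E > (2 + \<delta>) * e * n} \<le> 512 / (\<delta>\<^sup>2 * (e ^ 3 * n)) + exp (- (\<delta> / 2 * (e ^ 3 * n)))"
proof -
  define x where "x = real n"
  define p where "p = (1 + e) / x"
  define a where "a = nat \<lceil>\<delta> / 4 * e\<^sup>2 * x\<rceil>"
  define j where "j = nat \<lceil>(2 + \<delta>) * e * x\<rceil>"
  define d where "d = \<delta> * e\<^sup>2 * x / 8"
  have e1: "e \<le> 1 / 28" using e \<delta> by simp
  have ee: "e\<^sup>2 \<le> e / 28"
    using mult_left_mono[OF e1, of e] e by (simp add: power2_eq_square)
  have x: "0 < x" using en by (cases "n = 0") (auto simp: x_def)
  have dx: "8 \<le> \<delta> * e\<^sup>2 * x" using en by (simp add: x_def)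
  have "\<delta> * e\<^sup>2 * x \<le> 1 * e\<^sup>2 * x" using \<delta> x by (intro mult_right_mono) auto
  then have eex: "8 \<le> e\<^sup>2 * x" using dx by simp
  have "e\<^sup>2 * x \<le> e / 28 * x" using ee x by (intro mult_right_mono) auto
  moreover have "e / 28 * x \<le> 1 / 28 / 28 * x" using e1 x by (intro mult_right_mono) auto
  ultimately have ex: "8 \<le> e * x" "2 \<le> x" using eex by simp_all
  have p: "0 \<le> p" "p \<le> 1" using ex e e1 by (auto simp: p_def field_simps)
  have "d > 0" using \<delta> e x by (simp add: d_def)
  have a: "\<delta> / 4 * e\<^sup>2 * x \<le> a" "a \<le> \<delta> / 4 * e\<^sup>2 * x + 1"
    using dx unfolding a_def by linarith+
  have "\<delta> * e * x \<le> 1 * e * x" using \<delta> e x by (intro mult_right_mono) auto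
  moreover have "0 \<le> (2 + \<delta>) * e * x" using \<delta> e x by simp
  then have j: "(2 + \<delta>) * e * x \<le> j" "j \<le> (2 + \<delta>) * e * x + 1"
    unfolding j_def by linarith+
  ultimately have j4: "j \<le> 4 * e * x"
    using ex by (simp add: algebra_simps)
  have "2 * e * x \<le> (2 + \<delta>) * e * x" using \<delta> e x by (intro mult_right_mono) auto
  then have j2: "2 * e * x \<le> j" using j by linarith
  \<comment> \<open>In the mean, \<open>j\<close> steps discover fewer than \<open>j\<close>
    vertices, with a deficit of \<open>\<delta> * e\<^sup>2 * x / 2\<close>. Below,
    \<open>w = 1 / x\<close> records the \<open>- 1\<close> in \<open>j * (j - 1)\<close>.\<close>
  have decay: "x - j + \<delta> * e\<^sup>2 * x / 2 \<le> x * (1 - p) ^ j"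
  proof -
    define y w where "y = j / x" and "w = 1 / x"
    have w: "0 \<le> w" "w \<le> e\<^sup>2 / 8" using eex x by (auto simp: w_def field_simps)
    have y: "(2 + \<delta>) * e \<le> y" "y \<le> 4 * e"
      using j j4 x by (auto simp: y_def le_divide_eq divide_le_eq)
    have "y\<^sup>2 \<le> (4 * e)\<^sup>2" using y e \<delta> x by (intro power_mono) (auto simp: y_def)
    moreover have "(1 + e) ^ 3 \<le> (1 + 1 / 28) ^ 3" using e e1 by (intro power_mono) auto
    ultimately have "y\<^sup>2 * (1 + e) ^ 3 \<le> (4 * e)\<^sup>2 * (1 + 1 / 28) ^ 3"
      using e by (intro mult_mono) auto
    also have "\<dots> \<le> 36 * e\<^sup>2"
      by (simp add: power_mult_distrib power_divide)
    finally have 1: "y\<^sup>2 * (1 + e) ^ 3 / 6 \<le> 6 * e\<^sup>2" by simp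
    have "2 * e \<le> (2 + \<delta>) * e" using \<delta> e by (intro mult_right_mono) auto
    then have "0 \<le> y - w" using y w ee e by linarith
    moreover have "1 \<le> (1 + e)\<^sup>2" using e by (intro one_le_power) auto
    ultimately have "(y - w) * 1 \<le> (y - w) * (1 + e)\<^sup>2"
      by (rule mult_left_mono[rotated])
    \<comment> \<open>The cubic term and \<open>w\<close> together cost at most
      \<open>7 * e\<^sup>2\<close>, half of the gain \<open>\<delta> * e / 2\<close> from
      \<open>y \<ge> (2 + \<delta>) * e\<close>.\<close>
    moreover have "7 * e\<^sup>2 \<le> \<delta> * e / 4"
      using mult_right_mono[OF e(2), of e] e by (simp add: power2_eq_square)
    ultimately have "1 + e - (y - w) * (1 + e)\<^sup>2 / 2 + y\<^sup>2 * (1 + e) ^ 3 / 6 \<le> 1 - \<delta> * e / 4"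
      using 1 w y by (simp add: algebra_simps)
    then have "j * (1 + e - (y - w) * (1 + e)\<^sup>2 / 2 + y\<^sup>2 * (1 + e) ^ 3 / 6) \<le> j * (1 - \<delta> * e / 4)"
      by (intro mult_left_mono) auto
    then have "x - j * (1 - \<delta> * e / 4)
        \<le> x - j * (1 + e - (y - w) * (1 + e)\<^sup>2 / 2 + y\<^sup>2 * (1 + e) ^ 3 / 6)"
      by simp
    also have "\<dots> = x * (1 - j * p + j * (real j - 1) / 2 * p\<^sup>2 - j * (real j * real j) / 6 * p ^ 3)"
      using x by (simp add: y_def w_def p_def power2_eq_square power3_eq_cube field_simps)
    also have "\<dots> \<le> x * (1 - j * p + j * (real j - 1) / 2 * p\<^sup>2
        - j * (real j - 1) * (real j - 2) / 6 * p ^ 3)"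
    proof -
      have "(real j - 1) * (real j - 2) \<le> real j * real j"
        using j2 ex by (simp add: algebra_simps)
      then have "j * ((real j - 1) * (real j - 2)) / 6 * p ^ 3 \<le> j * (real j * real j) / 6 * p ^ 3"
        using p by (intro mult_right_mono divide_right_mono mult_left_mono) auto
      then show ?thesis
        using x by (intro mult_left_mono) (auto simp: mult.assoc)
    qed
    also have "\<dots> \<le> x * (1 - p) ^ j"
      using power_one_minus_ge[OF p] x by (intro mult_left_mono) auto
    finally have "x - j + j * (\<delta> * e / 4) \<le> x * (1 - p) ^ j"
      by (simp add: algebra_simps)
    moreover have "2 * e * x * (\<delta> * e / 4) \<le> j * (\<delta> * e / 4)"
      using j2 \<delta> e by (intro mult_right_mono) auto
    ultimately show ?thesis
      by (simp add: power2_eq_square algebra_simps)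
  qed
  have "measure_pmf.prob (random_graph p {1..n}) {E. j \<le> card (reach E A)}
      \<le> x * (real j * p) / d\<^sup>2" if A: "A \<subseteq> {1..n}" "card A \<le> a" for A
  proof -
    let ?u = "card ({1..n} - A)"
    have u: "real ?u = x - card A" "real ?u \<le> x"
      using A card_mono[OF _ A(1)] by (simp_all add: card_Diff_subset finite_subset x_def of_nat_diff)
    have q: "0 \<le> (1 - p) ^ j" "(1 - p) ^ j \<le> 1"
      using p by (auto intro: power_le_one)
    have "card A * (1 - p) ^ j \<le> real a * 1"
      using A q by (intro mult_mono) auto
    then have "x * (1 - p) ^ j - a \<le> ?u * (1 - p) ^ j"
      unfolding u by (simp add: algebra_simps)
    \<comment> \<open>The deficit is shared out: a half for \<open>a\<close> before rounding, a
      quarter for \<open>d\<close>, and a quarter for the rounding error 1.\<close>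
    then have "real (card {1..n}) - j \<le> ?u * (1 - p) ^ j - d"
      using decay a dx by (simp add: d_def x_def)
    then have "measure_pmf.prob (random_graph p {1..n}) {E. j \<le> card (reach E A)}
      \<le> sqdev (?u * (1 - p) ^ j) ((1 - p) ^ j) ?u / d\<^sup>2"
      using p A \<open>d > 0\<close> by (intro prob_card_reach_ge) auto
    also have "\<dots> \<le> x * (real j * p) / d\<^sup>2"
      using p u by (intro divide_right_mono sqdev_centre_le) auto
    finally show ?thesis .
  qed
  then have "measure_pmf.prob (random_graph p {1..n}) {E. j \<le> L1 {1..n} E}
      \<le> x * (real j * p) / d\<^sup>2 + (real (card {1..n} - j) / card {1..n}) ^ a"
    using x by (intro prob_L1_ge) (auto simp: x_def)
  moreover have "x * (real j * p) / d\<^sup>2 \<le> 512 / (\<delta>\<^sup>2 * (e ^ 3 * x))"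
  proof -
    have "j * (1 + e) \<le> (4 * e * x) * 2"
      using j4 e e1 x by (intro mult_mono) auto
    then have "j * (1 + e) / d\<^sup>2 \<le> (4 * e * x) * 2 / d\<^sup>2"
      by (intro divide_right_mono) auto
    also have "\<dots> = 512 / (\<delta>\<^sup>2 * (e ^ 3 * x))"
      using \<delta> e x by (simp add: d_def field_simps eval_nat_numeral)
    also have "j * (1 + e) = x * (real j * p)"
      using x by (simp add: p_def)
    finally show ?thesis .
  qed
  moreover have "(real (card {1..n} - j) / card {1..n}) ^ a \<le> exp (- (\<delta> / 2 * (e ^ 3 * x)))"
  proof -
    \<comment> \<open>For \<open>j > n\<close> the truncated subtraction gives 0.\<close>
    have "real (n - j) / x \<le> exp (- (j / x))"
    proof (cases "j \<le> n")
      case True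
      then have "real (n - j) / x = 1 + - (j / x)"
        using x by (simp add: x_def of_nat_diff diff_divide_distrib)
      then show ?thesis using exp_ge_add_one_self[of "- (j / x)"] by simp
    qed simp
    then have "(real (n - j) / x) ^ a \<le> exp (- (j / x)) ^ a"
      using x by (intro power_mono) auto
    also have "\<dots> = exp (- (a * (j / x)))"
      by (simp flip: exp_of_nat_mult)
    also have "\<dots> \<le> exp (- (\<delta> / 2 * (e ^ 3 * x)))"
    proof -
      have "2 * e \<le> j / x" using j2 x by (simp add: le_divide_eq)
      then have "(\<delta> / 4 * e\<^sup>2 * x) * (2 * e) \<le> a * (j / x)"
        using a \<delta> e x by (intro mult_mono) auto
      then show ?thesis by (simp add: power2_eq_square power3_eq_cube mult_ac)
    qed
    finally show ?thesis by (simp add: x_def)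
  qed
  moreover have "measure_pmf.prob (random_graph p {1..n}) {E. L1 {1..n} E > (2 + \<delta>) * e * x}
      \<le> measure_pmf.prob (random_graph p {1..n}) {E. j \<le> L1 {1..n} E}"
    by (intro measure_pmf.finite_measure_mono) (auto simp: j_def nat_le_iff ceiling_le_iff)
  ultimately show ?thesis
    by (simp add: p_def x_def)
qed

section \<open>Combination of the two bounds\<close>

lemma G_np_eq_random_graph: "G_np n p = random_graph p {1..n}"
  by (simp add: G_np_def random_graph_def random_subset_def)

theorem theorem1:
  fixes \<epsilon> p :: "nat \<Rightarrow> real"
  assumes "\<epsilon> \<longlonglongrightarrow> 0"
    and "filterlim (\<lambda>n. \<epsilon> n ^ 3 * real n) at_top sequentially"
    and "\<And>n. p n = (1 + \<epsilon> n) / real n"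
  shows "\<forall>\<delta>>0. (\<lambda>n. measure_pmf.prob (G_np n (p n))
           {E. (2 - \<delta>) * \<epsilon> n * real n \<le> real (L1 {1..n} E) \<and>
               real (L1 {1..n} E) \<le> (2 + \<delta>) * \<epsilon> n * real n}) \<longlonglongrightarrow> 1"
proof (intro allI impI)
  fix \<delta> :: real assume "0 < \<delta>"
  \<comment> \<open>\<open>\<delta> / 3\<close> matches the loss \<open>3 * \<eta>\<close> in the
    lower bound; the cap \<open>1 / 2\<close> meets the size restrictions of both bounds.\<close>
  define \<eta> where "\<eta> = min (\<delta> / 3) (1 / 2)"
  have \<eta>: "0 < \<eta>" "\<eta> \<le> 1 / 2" "3 * \<eta> \<le> \<delta>" "\<eta> \<le> \<delta>"
    using \<open>0 < \<delta>\<close> by (auto simp: \<eta>_def)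
  let ?g = "\<lambda>n. \<epsilon> n ^ 3 * real n"
  let ?bad = "\<lambda>n. 1024 / (\<eta> ^ 4 * ?g n) + (512 / (\<eta>\<^sup>2 * ?g n) + exp (- (\<eta> / 2 * ?g n)))"
  let ?P = "\<lambda>n. measure_pmf.prob (G_np n (p n))
           {E. (2 - \<delta>) * \<epsilon> n * real n \<le> real (L1 {1..n} E) \<and>
               real (L1 {1..n} E) \<le> (2 + \<delta>) * \<epsilon> n * real n}"
  have "((\<lambda>t. 1024 / (\<eta> ^ 4 * t) + (512 / (\<eta>\<^sup>2 * t) + exp (- (\<eta> / 2 * t)))) \<longlongrightarrow> 0) at_top"
    using \<eta>(1) by real_asymp
  then have "?bad \<longlonglongrightarrow> 0"
    by (rule filterlim_compose) (rule assms(2))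
  from tendsto_diff[OF tendsto_const this, of 1] have lower: "(\<lambda>n. 1 - ?bad n) \<longlonglongrightarrow> 1"
    by simp
  have "\<forall>\<^sub>F n in sequentially. \<epsilon> n < \<eta> / 28"
    using \<eta>(1) by (intro order_tendstoD(2)[OF assms(1)]) simp
  \<comment> \<open>This threshold forces \<open>\<epsilon> n > 0\<close> and, as
    \<open>\<epsilon> n \<le> 1\<close>, supplies all the size conditions of the two bounds.\<close>
  moreover have "\<forall>\<^sub>F n in sequentially. 8 / \<eta> \<le> ?g n"
    using assms(2) by (simp add: filterlim_at_top)
  ultimately have "\<forall>\<^sub>F n in sequentially. 1 - ?bad n \<le> ?P n"
  proof eventually_elim
    case (elim n)
    have "0 < 8 / \<eta>" using \<eta> by simp
    then have "0 < ?g n" using elim by linarith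
    then have e: "0 < \<epsilon> n" by (simp add: zero_less_mult_iff zero_less_power_eq)
    have e1: "\<epsilon> n \<le> 1" "28 * \<epsilon> n \<le> \<eta>" using elim \<eta> by auto
    have "8 \<le> \<eta> * ?g n" using elim(2) \<eta> by (simp add: divide_le_eq mult.commute)
    also have "\<dots> \<le> \<eta> * (\<epsilon> n ^ 2 * n)"
      using \<eta> e e1 by (intro mult_left_mono mult_right_mono power_decreasing) auto
    finally have 2: "8 \<le> \<eta> * (\<epsilon> n)\<^sup>2 * n" by (simp add: mult.assoc)
    also have "\<dots> \<le> \<eta> * \<epsilon> n * n"
      using \<eta> e e1 power_decreasing[of 1 2 "\<epsilon> n"] by (intro mult_left_mono mult_right_mono) auto
    finally have 1: "2 \<le> \<eta> * \<epsilon> n * n" by simp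
    have "\<eta> * ((\<epsilon> n)\<^sup>2 * n) \<le> 1 * ((\<epsilon> n)\<^sup>2 * n)"
      using \<eta> by (intro mult_right_mono) auto
    then have 3: "1 \<le> (\<epsilon> n)\<^sup>2 * n" using 2 by (simp add: mult.assoc)
    let ?M = "random_graph ((1 + \<epsilon> n) / n) {1..n}"
    let ?S = "{E. L1 {1..n} E < (2 - 3 * \<eta>) * \<epsilon> n * n}"
    let ?L = "{E. L1 {1..n} E > (2 + \<eta>) * \<epsilon> n * n}"
    let ?G = "{E. (2 - \<delta>) * \<epsilon> n * real n \<le> real (L1 {1..n} E) \<and>
               real (L1 {1..n} E) \<le> (2 + \<delta>) * \<epsilon> n * real n}"
    have "measure_pmf.prob ?M ?S \<le> 1024 / (\<eta> ^ 4 * ?g n)"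
      using prob_L1_too_small[OF \<eta>(1,2) e e1(2) 3 1] .
    moreover have "measure_pmf.prob ?M ?L \<le> 512 / (\<eta>\<^sup>2 * ?g n) + exp (- (\<eta> / 2 * ?g n))"
      using prob_L1_too_large[OF \<eta>(1) _ e e1(2) 2] \<eta> by simp
    moreover have "measure_pmf.prob ?M (- ?G) \<le> measure_pmf.prob ?M (?S \<union> ?L)"
    proof (rule measure_pmf.finite_measure_mono)
      have "(2 - \<delta>) * (\<epsilon> n * n) \<le> (2 - 3 * \<eta>) * (\<epsilon> n * n)"
        "(2 + \<eta>) * (\<epsilon> n * n) \<le> (2 + \<delta>) * (\<epsilon> n * n)"
        using e \<eta> by (auto intro!: mult_right_mono)
      then show "- ?G \<subseteq> ?S \<union> ?L" by (auto simp: mult.assoc)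
    qed simp
    moreover have "measure_pmf.prob ?M (?S \<union> ?L) \<le> measure_pmf.prob ?M ?S + measure_pmf.prob ?M ?L"
      by (rule measure_Un_le) auto
    moreover have "measure_pmf.prob ?M (- ?G) = 1 - measure_pmf.prob ?M ?G"
      using measure_pmf.prob_compl[of ?G ?M] by (simp add: Compl_eq_Diff_UNIV)
    ultimately show ?case
      unfolding G_np_eq_random_graph assms(3) by linarith
  qed
  moreover have "\<forall>\<^sub>F n in sequentially. ?P n \<le> 1"
    by simp
  ultimately show "?P \<longlonglongrightarrow> 1"
    using lower by (intro real_tendsto_sandwich[OF _ _ lower tendsto_const])
qed

end
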